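(* For every positive integer $n$, the $n\times n$ matrix $\left[\frac{1}{\beta(i,j)}\right]_{i,j=1}^{n}$ has the Cholesky decomposition $LL^{*}$, where $L=\left[\binom{i}{j}\sqrt{j}\right]_{i,j=1}^{n}$.
   Context: Here $\beta(x,y)=\frac{\Gamma(x)\Gamma(y)}{\Gamma(x+y)}$ is the beta function, so $\frac{1}{\beta(i,j)}=\frac{(i+j-1)!}{(i-1)!(j-1)!}$ for positive integers $i,j$. The Cholesky decomposition of a matrix $A$ is a factorization $A=LL^*$ with $L$ lower triangular. The convention $\binom{i}{j}=0$ for $j>i$ is used. *)

theory Defs
  imports "HOL-Analysis.Gamma_Function" "Jordan_Normal_Form.Schur_Decomposition"
begin

definition lower_triangular :: "'a :: zero mat \<Rightarrow> bool" where
  "lower_triangular A \<longleftrightarrow>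
     (\<forall>i < dim_row A. \<forall>j < dim_col A. i < j \<longrightarrow> A $$ (i, j) = 0)"

definition cholesky_decomposition ::
    "nat \<Rightarrow> 'a :: conjugatable_field mat \<Rightarrow> 'a mat \<Rightarrow> bool" where
  "cholesky_decomposition n A L \<longleftrightarrow>
     A \<in> carrier_mat n n \<and> L \<in> carrier_mat n n \<and>
     lower_triangular L \<and> A = L * mat_adjoint L"

(* Matrices are indexed from 0, so the entry written (i, j) with 1 <= i, j <= n
   is stored at position (i - 1, j - 1). *)

definition inverse_beta_mat :: "nat \<Rightarrow> complex mat" where
  "inverse_beta_mat n =
     mat n n (\<lambda>(i, j). complex_of_real (1 / Beta (real (i + 1)) (real (j + 1))))"

definition binomial_sqrt_mat :: "nat \<Rightarrow> complex mat" where
  "binomial_sqrt_mat n =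
     mat n n (\<lambda>(i, j). complex_of_real (real ((i + 1) choose (j + 1)) * sqrt (real (j + 1))))"

end

theory Submission
  imports Defs
begin

text \<open>
  The \<open>(a, b)\<close> entry of \<open>L L*\<close>, with indices counted from zero, is
  \<open>\<Sum>k. (k + 1) (a + 1 choose k + 1) (b + 1 choose k + 1)\<close>, because the two square roots
  multiply to \<open>k + 1\<close>. Absorbing this factor into the first binomial coefficient gives
  \<open>(a + 1) \<Sum>k. (a choose k) (b + 1 choose b - k)\<close>, and Vandermonde's convolution evaluates
  the sum to \<open>(a + 1) (a + b + 1 choose b) = (a + b + 1)! / (a! b!)\<close>. This is
  \<open>1 / Beta (a + 1) (b + 1)\<close>, since the Gamma function interpolates the factorial.
\<close>

lemma inverse_Beta_Suc:
  "1 / Beta (real (a + 1)) (real (b + 1)) = fact (a + b + 1) / (fact a * fact b)"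
proof -
  have "Gamma (real (m + 1)) = fact m" for m
    using Gamma_fact[of m, where ?'a = real] by (simp add: add.commute)
  from this[of a] this[of b] this[of "a + b + 1"] show ?thesis
    by (simp add: Beta_def add_ac)
qed

text \<open>
  The range of summation only has to reach the last nonzero term, so one identity serves the
  matrices of every size.
\<close>

lemma weighted_Vandermonde:
  assumes "b < n"
  shows "(\<Sum>k<n. (k + 1) * ((a + 1) choose (k + 1)) * ((b + 1) choose (k + 1)))
         = (a + 1) * ((a + b + 1) choose b)"
proof -
  have "(\<Sum>k<n. (k + 1) * ((a + 1) choose (k + 1)) * ((b + 1) choose (k + 1)))
        = (\<Sum>k\<le>b. (k + 1) * ((a + 1) choose (k + 1)) * ((b + 1) choose (k + 1)))"
    by (rule sum.mono_neutral_right) (use assms in \<open>auto simp: binomial_eq_0\<close>)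
  also have "\<dots> = (\<Sum>k\<le>b. (a + 1) * ((a choose k) * ((b + 1) choose (b - k))))"
  proof (rule sum.cong)
    fix k assume "k \<in> {..b}"
    then have "(b + 1) choose (k + 1) = (b + 1) choose (b - k)"
      by (subst binomial_symmetric) auto
    moreover have "(k + 1) * ((a + 1) choose (k + 1)) = (a + 1) * (a choose k)"
      using Suc_times_binomial[of k a] by (simp del: binomial_Suc_Suc)
    ultimately show "(k + 1) * ((a + 1) choose (k + 1)) * ((b + 1) choose (k + 1))
        = (a + 1) * ((a choose k) * ((b + 1) choose (b - k)))"
      by (simp only: mult.assoc)
  qed simp
  also have "\<dots> = (a + 1) * ((a + b + 1) choose b)"
    using vandermonde[of a "b + 1" b] by (simp add: add_ac flip: sum_distrib_left)
  finally show ?thesis .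
qed

lemma Suc_times_binomial_fact:
  "real ((a + 1) * ((a + b + 1) choose b)) = fact (a + b + 1) / (fact a * fact b)"
proof -
  have "real ((a + b + 1) choose b) = fact (a + b + 1) / (fact b * fact (a + 1))"
    using binomial_fact[of b "a + b + 1", where ?'a = real] by simp
  then show ?thesis
    by (simp add: field_simps del: of_nat_Suc fact_Suc) (simp add: field_simps)
qed

lemma sum_binomial_sqrt_products:
  assumes "b < n"
  shows "(\<Sum>k<n. (real ((a + 1) choose (k + 1)) * sqrt (real (k + 1))) *
                 (real ((b + 1) choose (k + 1)) * sqrt (real (k + 1))))
         = 1 / Beta (real (a + 1)) (real (b + 1))"
proof -
  have "(x * sqrt (real m)) * (y * sqrt (real m)) = real m * x * y" for x y m
    by (simp add: mult_ac)
  then have "(\<Sum>k<n. (real ((a + 1) choose (k + 1)) * sqrt (real (k + 1))) *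
                 (real ((b + 1) choose (k + 1)) * sqrt (real (k + 1))))
      = real (\<Sum>k<n. (k + 1) * ((a + 1) choose (k + 1)) * ((b + 1) choose (k + 1)))"
    by (simp only: of_nat_sum of_nat_mult)
  also have "\<dots> = 1 / Beta (real (a + 1)) (real (b + 1))"
    by (simp only: weighted_Vandermonde[OF assms] Suc_times_binomial_fact inverse_Beta_Suc)
  finally show ?thesis .
qed

lemma index_mult_mat_adjoint:
  assumes "A \<in> carrier_mat n m" "B \<in> carrier_mat p m" "i < n" "j < p"
  shows "(A * mat_adjoint B) $$ (i, j) = (\<Sum>k<m. A $$ (i, k) * conjugate (B $$ (j, k)))"
  using assms
  by (auto simp: mat_adjoint_def scalar_prod_def mat_of_rows_def atLeast0LessThan
           intro!: sum.cong)

theorem theorem2p4: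
  fixes n :: nat
  assumes "n \<ge> 1"
  shows "cholesky_decomposition n (inverse_beta_mat n) (binomial_sqrt_mat n)"
proof -
  let ?A = "inverse_beta_mat n" and ?L = "binomial_sqrt_mat n"
  have A: "?A \<in> carrier_mat n n" and L: "?L \<in> carrier_mat n n"
    by (simp_all add: inverse_beta_mat_def binomial_sqrt_mat_def)
  have "lower_triangular ?L"
    by (simp add: lower_triangular_def binomial_sqrt_mat_def binomial_eq_0
             del: binomial_Suc_Suc)
  moreover have "?A = ?L * mat_adjoint ?L"
  proof (rule eq_matI)
    fix i j assume "i < dim_row (?L * mat_adjoint ?L)" "j < dim_col (?L * mat_adjoint ?L)"
    then have i: "i < n" and j: "j < n"
      using L by (auto simp: mat_adjoint_def)
    have "(?L * mat_adjoint ?L) $$ (i, j) = (\<Sum>k<n. ?L $$ (i, k) * conjugate (?L $$ (j, k)))"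
      using index_mult_mat_adjoint[OF L L i j] .
    also have "\<dots> = complex_of_real
        (\<Sum>k<n. (real ((i + 1) choose (k + 1)) * sqrt (real (k + 1))) *
               (real ((j + 1) choose (k + 1)) * sqrt (real (k + 1))))"
      unfolding of_real_sum
      by (rule sum.cong) (use i j in \<open>simp_all add: binomial_sqrt_mat_def del: binomial_Suc_Suc\<close>)
    also have "\<dots> = ?A $$ (i, j)"
      using i j by (simp only: sum_binomial_sqrt_products) (simp add: inverse_beta_mat_def)
    finally show "?A $$ (i, j) = (?L * mat_adjoint ?L) $$ (i, j)" ..
  qed (use A L in \<open>auto simp: mat_adjoint_def\<close>)
  ultimately show ?thesis
    using A L by (simp add: cholesky_decomposition_def)
qed

end
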